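(* (i) For every integer $d\geq 2$, the directed graph $\mathcal{G}_d$ of O-sequences of multiplicity $d$ contains a spanning tree $\mathcal{T}_d$ with root the O-sequence $(1,d-1)$. (ii) For all integers $d\geq s\geq 2$, the subgraph $\mathcal{G}_d^s$ of O-sequences of multiplicity $d$ and length $s$ contains a spanning tree $\mathcal{T}_d^s$ with root the O-sequence $\mathsf{h}^s(d)=(1,d-s+1,1^{s-2})$. Thus, $\mathcal{G}_d^s$ is also connected.
   Context: Binomial expansion: for positive integers $a,t$ write uniquely $a=\binom{k(t)}{t}+\binom{k(t-1)}{t-1}+\cdots+\binom{k(j)}{j}$ with $k(t)>k(t-1)>\cdots>k(j)\geq j\geq 1$, and set $a^{\langle t\rangle}:=\binom{k(t)+1}{t+1}+\binom{k(t-1)+1}{t}+\cdots+\binom{k(j)+1}{j+1}$; also $0^{\langle t\rangle}:=0$. A function $\mathsf{h}:\mathbb{N}\to\mathbb{N}$ is an O-sequence (admissible) if $\mathsf{h}(0)=1$ and $\mathsf{h}(t+1)\leq \mathsf{h}(t)^{\langle t\rangle}$ for every $t\geq 1$. It is finite if $\mathsf{h}(t)=0$ for some $t$ (and then for all larger arguments); a finite O-sequence is written $(h_0,\ldots,h_{s-1})$ with $h_{s-1}\neq 0$, $s$ is its length, and $e(\mathsf{h})=\sum_{i=0}^{s-1}h_i$ is its multiplicity. Finite sequences are extended by zeros when added or subtracted, and $\mathsf{e}_i$ denotes the sequence that is $1$ at index $i$ (indices starting from $0$) and $0$ elsewhere. The notation $1^{s-2}$ inside a sequence means $s-2$ consecutive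 entries equal to $1$. $\mathcal{G}_d$ denotes the set of finite O-sequences of multiplicity $d$, regarded as a directed graph: there is an edge from $\mathsf{h}'$ to $\mathsf{h}$ (both in $\mathcal{G}_d$) exactly when $\mathsf{h}=\mathsf{h}'+\mathsf{e}_j-\mathsf{e}_i$ for some indices $j>i$. $\mathcal{G}_d^s$ is the subgraph induced on the O-sequences of multiplicity $d$ and length $s$. A spanning tree with root $r$ is a subgraph with the same vertices in which every vertex is reached from $r$ by a unique directed path. *)

theory Defs
  imports "Graph_Theory.Graph_Theory" "HOL-Library.More_List"
begin

section \<open>Binomial expansions and O-sequences\<close>

text \<open>
  The coefficients \<open>k(t) > \<dots> > k(j)\<close> are the values on \<open>{j..t}\<close> of a function \<open>k\<close>; its values
  elsewhere are irrelevant.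
\<close>
definition binomial_expansion :: "nat \<Rightarrow> nat \<Rightarrow> nat \<Rightarrow> (nat \<Rightarrow> nat) \<Rightarrow> bool" where
  "binomial_expansion a t j k \<longleftrightarrow>
     1 \<le> j \<and> j \<le> t \<and> j \<le> k j \<and> strict_mono_on {j..t} k \<and> a = (\<Sum>i = j..t. k i choose i)"

text \<open>
  The number \<open>a\<^sup>\<langle>\<^sup>t\<^sup>\<rangle>\<close>. It is only meaningful for \<open>t \<ge> 1\<close>; then, for \<open>a \<ge> 1\<close>, the expansion of \<open>a\<close>
  is unique (up to the irrelevant values of \<open>k\<close>), so that the definite description is well defined.
\<close>
definition binomial_shift :: "nat \<Rightarrow> nat \<Rightarrow> nat" where
  "binomial_shift a t =
     (if a = 0 then 0
      else (THE b. \<exists>j k. binomial_expansion a t j k \<and>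
                         b = (\<Sum>i = j..t. Suc (k i) choose Suc i)))"

definition O_sequence :: "(nat \<Rightarrow> nat) \<Rightarrow> bool" where
  "O_sequence h \<longleftrightarrow> h 0 = 1 \<and> (\<forall>t\<ge>1. h (Suc t) \<le> binomial_shift (h t) t)"

definition finite_O_sequence :: "(nat \<Rightarrow> nat) \<Rightarrow> bool" where
  "finite_O_sequence h \<longleftrightarrow> O_sequence h \<and> (\<exists>t. h t = 0)"

text \<open>
  Finite sequences \<open>(h\<^sub>0, \<dots>, h\<^bsub>s-1\<^esub>)\<close> with \<open>h\<^bsub>s-1\<^esub> \<noteq> 0\<close> are represented by their extension by zeros,
  so the length is the least index from which on all entries vanish.
\<close>
definition seq_length :: "(nat \<Rightarrow> nat) \<Rightarrow> nat" where
  "seq_length h = (LEAST s. \<forall>t\<ge>s. h t = 0)"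

definition multiplicity_of :: "(nat \<Rightarrow> nat) \<Rightarrow> nat" where
  "multiplicity_of h = (\<Sum>i<seq_length h. h i)"

abbreviation seq_of_list :: "nat list \<Rightarrow> nat \<Rightarrow> nat" where
  "seq_of_list \<equiv> nth_default 0"

definition unit_seq :: "nat \<Rightarrow> nat \<Rightarrow> int" where
  "unit_seq i n = (if n = i then 1 else 0)"


section \<open>The graphs of O-sequences\<close>

definition O_sequences :: "nat \<Rightarrow> (nat \<Rightarrow> nat) set" where
  "O_sequences d = {h. finite_O_sequence h \<and> multiplicity_of h = d}"

text \<open>Edges are compared in \<^typ>\<open>int\<close>, as subtraction on \<^typ>\<open>nat\<close> is truncated.\<close>
definition O_graph :: "nat \<Rightarrow> (nat \<Rightarrow> nat, (nat \<Rightarrow> nat) \<times> (nat \<Rightarrow> nat)) pre_digraph" where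
  "O_graph d = with_proj
     \<lparr> pverts = O_sequences d,
       parcs = {(h', h). h' \<in> O_sequences d \<and> h \<in> O_sequences d \<and>
                 (\<exists>i j. i < j \<and> (\<forall>n. int (h n) = int (h' n) + unit_seq j n - unit_seq i n))} \<rparr>"

definition O_graph_length ::
    "nat \<Rightarrow> nat \<Rightarrow> (nat \<Rightarrow> nat, (nat \<Rightarrow> nat) \<times> (nat \<Rightarrow> nat)) pre_digraph" where
  "O_graph_length d s = O_graph d \<restriction> {h \<in> O_sequences d. seq_length h = s}"

text \<open>
  The predicate \<open>spanning_tree\<close> of \<open>Graph_Theory\<close> is unrooted and asks for weak connectedness.
  Here uniqueness is required among all directed walks from the root. Such a unique walk
  repeats no vertex, so it is a path; uniqueness among paths alone would not exclude
  additional arcs leading back to earlier vertices.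
\<close>
definition rooted_spanning_tree ::
    "('a, 'b) pre_digraph \<Rightarrow> ('a, 'b) pre_digraph \<Rightarrow> 'a \<Rightarrow> bool" where
  "rooted_spanning_tree T G r \<longleftrightarrow>
     spanning T G \<and> r \<in> verts T \<and> (\<forall>v \<in> verts T. \<exists>!p. pre_digraph.awalk T r p v)"

end

theory Submission
  imports Defs
begin

text \<open>
  Macaulay expansions are compared lexicographically from the top coefficient down, so that
  \<open>a \<mapsto> a\<^sup>\<langle>\<^sup>t\<^sup>\<rangle>\<close> is monotone; it is positive on positive \<open>a\<close>. Since an O-sequence places no condition
  on the entry at 1, moving one unit from an index \<open>j \<ge> 2\<close> to the index 1 can only violate
  admissibility at the step from \<open>j\<close> to \<open>j + 1\<close>. For the last \<open>j\<close> with \<open>h\<^sub>j \<noteq> 0\<close> that step is trivial,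
  and for the last \<open>j\<close> with \<open>h\<^sub>j \<ge> 2\<close> it reads \<open>h\<^bsub>j+1\<^esub> \<le> 1 \<le> (h\<^sub>j - 1)\<^sup>\<langle>\<^sup>j\<^sup>\<rangle>\<close>. So every O-sequence other
  than the root has an in-neighbour with a larger entry at 1 (of the same length in the second case).
  As the entry at 1 is bounded by the multiplicity, one such arc per vertex makes up the tree.
\<close>

section \<open>Monotonicity of the binomial shift\<close>

text \<open>Peeling off the top summand drives the inductions on \<open>t\<close>: the remainder
  \<open>r\<close> is expanded by the same \<open>j\<close> and \<open>k\<close> one degree lower,
  and \<open>k u < k t\<close> records how the two levels are linked.\<close>

lemma binomial_expansion_cases:
  assumes "binomial_expansion a t j k"
  obtains (single) "j = t" "1 \<le> t" "t \<le> k t" "a = k t choose t"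
  | (snoc) u r where "t = Suc u" "j \<le> u" "binomial_expansion r u j k" "k u < k t"
      "a = r + (k t choose t)"
proof (cases "j = t")
  case True
  then show thesis using assms single by (simp add: binomial_expansion_def)
next
  case False
  then obtain u where u: "t = Suc u" "j \<le> u"
    using assms by (cases t) (auto simp: binomial_expansion_def)
  have "strict_mono_on {j..u} k"
    using assms u by (auto simp: binomial_expansion_def strict_mono_on_def)
  then have "binomial_expansion (\<Sum>i=j..u. k i choose i) u j k"
    using assms u by (auto simp: binomial_expansion_def)
  moreover have "k u < k t"
    using assms u by (auto simp: binomial_expansion_def strict_mono_on_def)
  moreover have "a = (\<Sum>i=j..u. k i choose i) + (k t choose t)"
    using assms u by (simp add: binomial_expansion_def)
  ultimately show thesis using u snoc by blast
qed

section \<open>Bounds by the top coefficient, and existence of expansions\<close>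

lemma binomial_expansion_top_ge:
  "binomial_expansion a t j k \<Longrightarrow> t \<le> k t"
proof (induction t arbitrary: a)
  case (Suc t)
  from Suc.prems show ?case
  proof (cases rule: binomial_expansion_cases)
    case (snoc u r)
    then show ?thesis using Suc.IH[of r] by simp
  qed
qed simp

lemma binomial_expansion_ge_top:
  "binomial_expansion a t j k \<Longrightarrow> k t choose t \<le> a"
  by (erule binomial_expansion_cases) auto

lemma binomial_expansion_pos:
  "binomial_expansion a t j k \<Longrightarrow> 0 < a"
  using binomial_expansion_ge_top[of a t j k] binomial_expansion_top_ge[of a t j k]
    zero_less_binomial[of t "k t"] by linarith

text \<open>By Pascal's rule the remainder only has to stay below \<open>k t choose (t - 1)\<close>,
  which follows inductively from \<open>k (t - 1) < k t\<close>. With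
  \<open>binomial_expansion_ge_top\<close> this makes \<open>k t\<close> the largest
  \<open>m\<close> with \<open>m choose t \<le> a\<close>.\<close>

lemma binomial_expansion_less:
  "binomial_expansion a t j k \<Longrightarrow> a < Suc (k t) choose t"
proof (induction t arbitrary: a)
  case 0
  then show ?case by (auto simp: binomial_expansion_def)
next
  case (Suc t)
  from Suc.prems show ?case
  proof (cases rule: binomial_expansion_cases)
    case single
    then show ?thesis by simp
  next
    case (snoc u r)
    then have "r < Suc (k t) choose t" using Suc.IH by simp
    also have "\<dots> \<le> k (Suc t) choose t"
      using snoc by (intro binomial_right_mono) simp
    finally show ?thesis using snoc by simp
  qed
qed

lemma binomial_expansion_exists:
  assumes "1 \<le> t" "0 < a"
  shows "\<exists>j k. binomial_expansion a t j k"
  using assms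
proof (induction t arbitrary: a)
  case (Suc t)
  let ?P = "\<lambda>m. m choose Suc t \<le> a"
  \<comment> \<open>Greedy choice of the top coefficient; \<open>bound\<close> ensures that the
    greatest \<open>m\<close> exists.\<close>
  define m where "m = (GREATEST m. ?P m)"
  have bound: "y \<le> a + Suc t" if "?P y" for y
  proof (rule ccontr)
    assume "\<not> y \<le> a + Suc t"
    then have "Suc a + t choose Suc t \<le> y choose Suc t"
      by (intro binomial_right_mono) simp
    moreover have "a < Suc a + t choose Suc t"
      by (induction t) auto
    ultimately show False using that by simp
  qed
  have "?P (Suc t)" using Suc.prems by simp
  then have Pm: "?P m" unfolding m_def using bound by (rule GreatestI_nat)
  have "Suc t \<le> m"
    unfolding m_def using \<open>?P (Suc t)\<close> bound by (rule Greatest_le_nat)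
  have "\<not> ?P (Suc m)"
    using Greatest_le_nat[of ?P "Suc m", OF _ bound] by (auto simp: m_def)
  then have less: "a < Suc m choose Suc t" by simp
  show ?case
  proof (cases "a = m choose Suc t")
    case True
    with \<open>Suc t \<le> m\<close> have "binomial_expansion a (Suc t) (Suc t) (\<lambda>_. m)"
      by (simp add: binomial_expansion_def strict_mono_on_def)
    then show ?thesis by blast
  next
    case False
    define r where "r = a - (m choose Suc t)"
    \<comment> \<open>Pascal's rule turns \<open>a < Suc m choose Suc t\<close> into
      \<open>r < m choose t\<close>. This keeps the coefficients of \<open>r\<close> below
      \<open>m\<close>, and it excludes \<open>t = 0\<close>, where \<open>r\<close> would
      vanish.\<close>
    have r: "0 < r" "a = r + (m choose Suc t)" "r < m choose t"
      using False Pm less by (auto simp: r_def)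
    then have "1 \<le> t" by (cases t) auto
    then obtain j k where jk: "binomial_expansion r t j k"
      using Suc.IH r by blast
    have "k t < m"
      using binomial_expansion_ge_top[OF jk] r(3) binomial_right_mono[of m "k t" t]
      by linarith
    have le: "k i \<le> k t" if "i \<in> {j..t}" for i
      using jk that strict_mono_onD[of "{j..t}" k i t]
      by (cases "i = t") (auto simp: binomial_expansion_def)
    have "binomial_expansion a (Suc t) j (k(Suc t := m))"
      unfolding binomial_expansion_def
    proof (intro conjI)
      show "strict_mono_on {j..Suc t} (k(Suc t := m))"
      proof (rule strict_mono_onI)
        fix x y assume xy: "x \<in> {j..Suc t}" "y \<in> {j..Suc t}" "x < y"
        then have x: "x \<in> {j..t}" by auto
        show "(k(Suc t := m)) x < (k(Suc t := m)) y"
        proof (cases "y = Suc t")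
          case True
          then show ?thesis using le[OF x] \<open>k t < m\<close> xy by simp
        next
          case False
          then show ?thesis
            using jk x xy by (auto simp: binomial_expansion_def strict_mono_on_def)
        qed
      qed
      have "(\<Sum>i = j..t. (k(Suc t := m)) i choose i) = (\<Sum>i = j..t. k i choose i)"
        by (rule sum.cong) auto
      then show "a = (\<Sum>i = j..Suc t. (k(Suc t := m)) i choose i)"
        using jk r by (simp add: binomial_expansion_def)
    qed (use jk in \<open>auto simp: binomial_expansion_def\<close>)
    then show ?thesis by blast
  qed
qed simp

text \<open>Exhibits the shifted sum as an expansion one degree higher, so that the bounds on
  expansions apply to it. In \<open>i - 1\<close> nothing is truncated, since the indices start at
  \<open>Suc j\<close>.\<close>

lemma binomial_expansion_Suc:
  assumes "binomial_expansion a t j k"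
  shows "binomial_expansion (\<Sum>i=j..t. Suc (k i) choose Suc i) (Suc t) (Suc j)
           (\<lambda>i. Suc (k (i - 1)))"
  unfolding binomial_expansion_def
proof (intro conjI)
  show "strict_mono_on {Suc j..Suc t} (\<lambda>i. Suc (k (i - 1)))"
  proof (rule strict_mono_onI)
    fix x y assume "x \<in> {Suc j..Suc t}" "y \<in> {Suc j..Suc t}" "x < y"
    then have "x - 1 \<in> {j..t}" "y - 1 \<in> {j..t}" "x - 1 < y - 1" by auto
    then show "Suc (k (x - 1)) < Suc (k (y - 1))"
      using assms by (auto simp only: binomial_expansion_def strict_mono_on_def Suc_less_eq)
  qed
  show "(\<Sum>i=j..t. Suc (k i) choose Suc i) = (\<Sum>i=Suc j..Suc t. Suc (k (i - 1)) choose i)"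
    by (simp only: sum.shift_bounds_cl_Suc_ivl diff_Suc_1)
qed (use assms in \<open>auto simp: binomial_expansion_def\<close>)

text \<open>Unequal top coefficients decide the comparison; for equal ones the top summands cancel
  and the remainders are compared by induction.\<close>

lemma binomial_expansion_shift_mono:
  assumes "binomial_expansion a t j k" "binomial_expansion a' t j' k'" "a \<le> a'"
  shows "(\<Sum>i=j..t. Suc (k i) choose Suc i) \<le> (\<Sum>i=j'..t. Suc (k' i) choose Suc i)"
  using assms
proof (induction t arbitrary: a a')
  case 0
  then show ?case by (auto simp: binomial_expansion_def)
next
  case (Suc t)
  let ?b = "\<Sum>i=j..Suc t. Suc (k i) choose Suc i"
  let ?b' = "\<Sum>i=j'..Suc t. Suc (k' i) choose Suc i"
  consider "k (Suc t) < k' (Suc t)" | "k' (Suc t) < k (Suc t)" | "k (Suc t) = k' (Suc t)"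
    by linarith
  then show ?case
  proof cases
    case 1
    have "?b < Suc (Suc (k (Suc t))) choose Suc (Suc t)"
      using binomial_expansion_less[OF binomial_expansion_Suc[OF Suc.prems(1)]] by simp
    also have "\<dots> \<le> Suc (k' (Suc t)) choose Suc (Suc t)"
      using 1 by (intro binomial_right_mono) simp
    also have "\<dots> \<le> ?b'"
      using binomial_expansion_ge_top[OF binomial_expansion_Suc[OF Suc.prems(2)]] by simp
    finally show ?thesis by simp
  next
    \<comment> \<open>Impossible: the larger top coefficient would give
      \<open>a' < a\<close>.\<close>
    case 2
    have "a' < Suc (k' (Suc t)) choose Suc t" by (rule binomial_expansion_less[OF Suc.prems(2)])
    also have "\<dots> \<le> k (Suc t) choose Suc t" using 2 by (intro binomial_right_mono) simp
    also have "\<dots> \<le> a" by (rule binomial_expansion_ge_top[OF Suc.prems(1)])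
    finally show ?thesis using Suc.prems(3) by simp
  next
    case 3
    from Suc.prems(1) show ?thesis
    proof (cases rule: binomial_expansion_cases)
      case single
      then have "?b = Suc (k' (Suc t)) choose Suc (Suc t)" using 3 by simp
      also have "\<dots> \<le> ?b'"
        using binomial_expansion_ge_top[OF binomial_expansion_Suc[OF Suc.prems(2)]] by simp
      finally show ?thesis .
    next
      case (snoc u r)
      note snoc1 = snoc
      from Suc.prems(2) show ?thesis
      proof (cases rule: binomial_expansion_cases)
        \<comment> \<open>Impossible: \<open>a\<close> exceeds the common top binomial by
          \<open>r > 0\<close>, while \<open>a'\<close> equals it.\<close>
        case single
        then show ?thesis
          using snoc1 3 Suc.prems(3) binomial_expansion_pos[of r u j k] by simp
      next
        case (snoc u' r')
        then have "(\<Sum>i=j..t. Suc (k i) choose Suc i) \<le> (\<Sum>i=j'..t. Suc (k' i) choose Suc i)"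
          using snoc1 3 Suc.prems(3) by (intro Suc.IH[of r r']) auto
        then show ?thesis using snoc1 snoc 3 by simp
      qed
    qed
  qed
qed

text \<open>The description is well defined: \<open>binomial_expansion_shift_mono\<close>, used in
  both directions with \<open>a = a'\<close>, shows that any two expansions of \<open>a\<close> have
  the same shifted sum.\<close>

lemma binomial_shift_eq:
  assumes "binomial_expansion a t j k"
  shows "binomial_shift a t = (\<Sum>i=j..t. Suc (k i) choose Suc i)"
proof -
  have "(THE b. \<exists>j k. binomial_expansion a t j k \<and> b = (\<Sum>i=j..t. Suc (k i) choose Suc i)) =
      (\<Sum>i=j..t. Suc (k i) choose Suc i)"
  proof (rule the_equality)
    fix b assume "\<exists>j k. binomial_expansion a t j k \<and> b = (\<Sum>i=j..t. Suc (k i) choose Suc i)"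
    then show "b = (\<Sum>i=j..t. Suc (k i) choose Suc i)"
      using assms binomial_expansion_shift_mono[OF _ _ order.refl]
      by (auto intro: order.antisym)
  qed (use assms in blast)
  then show ?thesis using binomial_expansion_pos[OF assms] by (simp add: binomial_shift_def)
qed

lemma binomial_shift_mono:
  assumes "1 \<le> t" "a \<le> b"
  shows "binomial_shift a t \<le> binomial_shift b t"
proof (cases "a = 0")
  case True
  then show ?thesis by (simp add: binomial_shift_def)
next
  case False
  then obtain j k j' k' where jk: "binomial_expansion a t j k" "binomial_expansion b t j' k'"
    using binomial_expansion_exists[of t a] binomial_expansion_exists[of t b] assms by auto
  then show ?thesis
    using binomial_expansion_shift_mono[OF jk assms(2)] by (simp add: binomial_shift_eq)
qed

text \<open>Ensures that an entry 1 may follow any positive entry at an index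
  \<open>t \<ge> 1\<close>.\<close>

lemma binomial_shift_pos:
  assumes "1 \<le> t" "0 < a"
  shows "0 < binomial_shift a t"
proof -
  obtain j k where jk: "binomial_expansion a t j k"
    using binomial_expansion_exists assms by blast
  then show ?thesis
    using binomial_expansion_pos[OF binomial_expansion_Suc[OF jk]] by (simp add: binomial_shift_eq)
qed


section \<open>Length and multiplicity\<close>

lemma seq_length_eqI:
  assumes "\<And>t. 0 < h t \<longleftrightarrow> t < s"
  shows "seq_length h = s"
  unfolding seq_length_def
proof (rule Least_equality)
  show "\<forall>t\<ge>s. h t = 0" using assms leD by blast
next
  fix y assume "\<forall>t\<ge>y. h t = 0"
  then have "\<not> 0 < h y" by simp
  then show "s \<le> y" using assms by simp
qed

text \<open>A zero entry forces all later ones to vanish, because the shift of 0 is 0; hence the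
  support is an initial segment.\<close>

lemma finite_O_sequence_pos_iff:
  assumes "finite_O_sequence h"
  shows "0 < h t \<longleftrightarrow> t < seq_length h"
proof -
  have h: "O_sequence h" and ex: "\<exists>t. h t = 0"
    using assms by (auto simp: finite_O_sequence_def)
  define s where "s = (LEAST t. h t = 0)"
  have "h s = 0" unfolding s_def by (rule LeastI_ex[OF ex])
  \<comment> \<open>The growth condition starts at index 1, so the first zero must not sit at index
    0.\<close>
  then have "1 \<le> s" using h by (cases s) (auto simp: O_sequence_def)
  have zero: "h t = 0" if "s \<le> t" for t
    using that
  proof (induction t rule: dec_induct)
    case (step n)
    have "1 \<le> n" using step(1) \<open>1 \<le> s\<close> by simp
    then have "h (Suc n) \<le> binomial_shift (h n) n"
      using h unfolding O_sequence_def by blast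
    then show ?case using step by (simp add: binomial_shift_def)
  qed fact
  have pos: "0 < h t \<longleftrightarrow> t < s" for t
  proof
    show "t < s" if "0 < h t" using that zero[of t] by (metis less_irrefl not_less)
    show "0 < h t" if "t < s" using not_less_Least[OF that[unfolded s_def]] by simp
  qed
  then show ?thesis using seq_length_eqI[of h s] by simp
qed

text \<open>Allows sequences of different lengths to be summed over a common range.\<close>

lemma multiplicity_of_eq_sum:
  assumes "finite_O_sequence h" "seq_length h \<le> N"
  shows "multiplicity_of h = (\<Sum>i<N. h i)"
  unfolding multiplicity_of_def
proof (rule sum.mono_neutral_left)
  show "\<forall>i\<in>{..<N} - {..<seq_length h}. h i = 0"
    using finite_O_sequence_pos_iff[OF assms(1)] by (metis DiffD2 gr0I lessThan_iff)
qed (use assms in auto)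

lemma O_sequences_entry_le:
  assumes "h \<in> O_sequences d"
  shows "h i \<le> d"
proof (cases "i < seq_length h")
  case True
  then have "h i \<le> (\<Sum>i<seq_length h. h i)"
    by (intro member_le_sum) auto
  then show ?thesis using assms by (simp add: O_sequences_def multiplicity_of_def)
next
  case False
  then show ?thesis using assms finite_O_sequence_pos_iff[of h i] by (simp add: O_sequences_def)
qed

lemma O_sequences_transfer:
  fixes h :: "nat \<Rightarrow> nat"
  assumes h: "h \<in> O_sequences d" and j: "1 < j" "0 < h j"
    and step: "h (Suc j) \<le> binomial_shift (h j - 1) j"
  defines "h' \<equiv> h(1 := Suc (h 1), j := h j - 1)"
  shows "h' \<in> O_sequences d" "(h', h) \<in> arcs (O_graph d)"
proof -
  have fin: "finite_O_sequence h" and mult: "multiplicity_of h = d"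
    using h by (auto simp: O_sequences_def)
  note pos = finite_O_sequence_pos_iff[OF fin]
  have diff: "int (h n) = int (h' n) + unit_seq j n - unit_seq 1 n" for n
    using j by (auto simp: h'_def unit_seq_def)
  have "h' (Suc t) \<le> binomial_shift (h' t) t" if "1 \<le> t" for t
  proof -
    have "h (Suc t) \<le> binomial_shift (h t) t"
      using fin that by (auto simp: finite_O_sequence_def O_sequence_def)
    \<comment> \<open>Only index 1 gains a unit, and \<open>Suc t\<close> is at least 2.\<close>
    moreover have "h' (Suc t) \<le> h (Suc t)"
      using that by (simp add: h'_def)
    moreover have "binomial_shift (h t) t \<le> binomial_shift (h' t) t" if "t \<noteq> j"
      using that \<open>1 \<le> t\<close> by (intro binomial_shift_mono) (auto simp: h'_def)
    ultimately show ?thesis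
      using step by (cases "t = j") (auto simp: h'_def)
  qed
  moreover have "h' 0 = 1"
    using fin j by (simp add: h'_def finite_O_sequence_def O_sequence_def)
  ultimately have O': "O_sequence h'" by (simp add: O_sequence_def)
  have len: "j < seq_length h" using pos j by blast
  have zero: "h' t = 0" if "seq_length h \<le> t" for t
    using that pos[of t] j len by (auto simp: h'_def)
  have fin': "finite_O_sequence h'"
    using O' zero by (auto simp: finite_O_sequence_def)
  \<comment> \<open>The length drops when \<open>j\<close> is the last index and
    \<open>h j = 1\<close>; both multiplicities are therefore summed over the range of
    \<open>h\<close>.\<close>
  have "seq_length h' \<le> seq_length h"
    using finite_O_sequence_pos_iff[OF fin', of "seq_length h"] zero by force
  then have "multiplicity_of h' = (\<Sum>i<seq_length h. h' i)"
    by (rule multiplicity_of_eq_sum[OF fin'])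
  moreover have "int d = (\<Sum>i<seq_length h. int (h i))"
    using mult by (simp add: multiplicity_of_def flip: of_nat_sum)
  \<comment> \<open>Both 1 and \<open>j\<close> lie in the range, so the two unit sequences cancel
    in the sum.\<close>
  moreover have "(\<Sum>i<seq_length h. unit_seq i' i) = 1" if "i' < seq_length h" for i'
    using that by (simp add: unit_seq_def)
  ultimately have "multiplicity_of h' = d"
    using len j by (simp add: diff sum.distrib sum_subtractf flip: of_nat_sum)
  then show h'_in: "h' \<in> O_sequences d"
    using fin' by (simp add: O_sequences_def)
  show "(h', h) \<in> arcs (O_graph d)"
    using h h'_in diff j(1) by (auto simp: O_graph_def)
qed


section \<open>Rooted spanning trees from decreasing arcs\<close>

text \<open>Keep one parent arc \<open>e v\<close> for each \<open>v \<noteq> r\<close>. The rank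
  drops towards the parent, so tracing back ends at \<open>r\<close>; every vertex has at most one
  incoming arc, so the walk is unique.\<close>

lemma rooted_spanning_tree_exists:
  fixes rank :: "'a \<Rightarrow> nat"
  assumes "wf_digraph G" and r: "r \<in> verts G"
    and parent: "\<And>v. v \<in> verts G \<Longrightarrow> v \<noteq> r \<Longrightarrow>
      \<exists>e \<in> arcs G. head G e = v \<and> rank (tail G e) < rank v"
  shows "\<exists>T. rooted_spanning_tree T G r"
proof -
  interpret G: wf_digraph G by fact
  have "\<forall>v \<in> verts G - {r}. \<exists>e. e \<in> arcs G \<and> head G e = v \<and> rank (tail G e) < rank v"
    using parent by blast
  then obtain e where
    "\<forall>v \<in> verts G - {r}. e v \<in> arcs G \<and> head G (e v) = v \<and> rank (tail G (e v)) < rank v"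
    by (rule bchoice[THEN exE])
  then have e: "e v \<in> arcs G" "head G (e v) = v" "rank (tail G (e v)) < rank v"
    if "v \<in> verts G" "v \<noteq> r" for v
    using that by auto
  define T where "T = \<lparr> verts = verts G, arcs = e ` (verts G - {r}), tail = tail G, head = head G \<rparr>"
  have T: "verts T = verts G" "tail T = tail G" "head T = head G" "arcs T = e ` (verts G - {r})"
    by (simp_all add: T_def)
  have sub: "arcs T \<subseteq> arcs G"
    unfolding T(4) using e(1) by blast
  interpret T: wf_digraph T
  proof
    fix a assume "a \<in> arcs T"
    then have "a \<in> arcs G" using sub by blast
    then show "tail T a \<in> verts T" "head T a \<in> verts T" by (simp_all add: T(1-3))
  qed
  have head_ne: "head G a \<noteq> r" and arc_eq: "a = e (head G a)" if a: "a \<in> arcs T" for a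
  proof -
    obtain v where v: "a = e v" "v \<in> verts G" "v \<noteq> r"
      using a unfolding T(4) by blast
    then show "head G a \<noteq> r" "a = e (head G a)"
      using e(2)[OF v(2,3)] by simp_all
  qed
  have "\<exists>!p. T.awalk r p v" if "v \<in> verts G" for v
    using that
  proof (induction "rank v" arbitrary: v rule: less_induct)
    case less
    show ?case
    proof (cases "v = r")
      case True
      \<comment> \<open>The last arc of a nonempty walk would have head \<open>r\<close>, contrary
        to \<open>head_ne\<close>.\<close>
      have "p = []" if "T.awalk r p r" for p
        using that head_ne
        by (cases p rule: rev_cases) (auto simp: T.awalk_Cons_iff T.awalk_Nil_iff T(3))
      moreover have "T.awalk r [] r" using r by (simp add: T.awalk_Nil_iff T(1))
      ultimately show ?thesis using True by blast
    next
      case False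
      let ?u = "tail G (e v)"
      have ev: "e v \<in> arcs T" using less.prems False by (simp add: T(4))
      have u: "?u \<in> verts G" "rank ?u < rank v"
        using e[OF less.prems False] by auto
      then obtain q where q: "T.awalk r q ?u" "\<And>p. T.awalk r p ?u \<Longrightarrow> p = q"
        using less.hyps by blast
      show ?thesis
      proof
        show "T.awalk r (q @ [e v]) v"
          using q(1) ev e[OF less.prems False] less.prems
          by (auto simp: T.awalk_Cons_iff T.awalk_Nil_iff T)
      next
        \<comment> \<open>The last arc of \<open>p\<close> has head \<open>v\<close>, hence is
          \<open>e v\<close>; the rest is a walk to the parent, unique by induction.\<close>
        fix p assume p: "T.awalk r p v"
        then obtain p' a where pa: "p = p' @ [a]"
          using False by (cases p rule: rev_cases) (auto simp: T.awalk_Nil_iff)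
        with p have "a \<in> arcs T" "head G a = v" "T.awalk r p' (tail G a)"
          by (auto simp: T.awalk_Cons_iff T.awalk_Nil_iff T)
        then show "p = q @ [e v]"
          using q(2) arc_eq[of a] pa by simp
      qed
    qed
  qed
  moreover have "spanning T G"
    unfolding spanning_def subgraph_def compatible_def
    using sub T(1-3) G.wf_digraph_axioms T.wf_digraph_axioms by simp
  ultimately have "rooted_spanning_tree T G r"
    using r by (simp add: rooted_spanning_tree_def T)
  then show ?thesis by blast
qed

text \<open>\<open>connected\<close> means strong connectedness of the symmetric closure, where any
  two vertices are joined through \<open>r\<close>; this passes from \<open>T\<close> to
  \<open>G\<close>, which has the same vertices.\<close>

lemma rooted_spanning_tree_imp_connected:
  assumes "rooted_spanning_tree T G r"
  shows "connected G"
proof -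
  have wf: "wf_digraph G" "wf_digraph T" and span: "spanning T G"
    using assms by (auto simp: rooted_spanning_tree_def spanning_def subgraph_def)
  interpret G: wf_digraph G by (rule wf)
  interpret T: wf_digraph T by (rule wf)
  interpret S: pair_wf_digraph "mk_symmetric T" ..
  have from_r: "r \<rightarrow>\<^sup>*\<^bsub>mk_symmetric T\<^esub> v" if "v \<in> verts T" for v
  proof (rule T.reachable_mk_symmetricI)
    show "r \<rightarrow>\<^sup>*\<^bsub>T\<^esub> v"
      unfolding T.reachable_awalk using assms that by (auto simp: rooted_spanning_tree_def)
  qed
  have "connected T"
    unfolding connected_def
  proof (rule strongly_connectedI)
    show "verts (with_proj (mk_symmetric T)) \<noteq> {}"
      using assms by (auto simp: rooted_spanning_tree_def)
    fix u v assume "u \<in> verts (with_proj (mk_symmetric T))" "v \<in> verts (with_proj (mk_symmetric T))"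
    then have u: "r \<rightarrow>\<^sup>*\<^bsub>mk_symmetric T\<^esub> u" and v: "r \<rightarrow>\<^sup>*\<^bsub>mk_symmetric T\<^esub> v"
      using from_r by auto
    show "u \<rightarrow>\<^sup>*\<^bsub>mk_symmetric T\<^esub> v"
      by (rule S.reachable_trans[OF symmetric_reachable[OF symmetric_mk_symmetric u] v])
  qed
  then show ?thesis by (rule G.connected_spanning_imp_connected[OF span])
qed


section \<open>The spanning trees of O-sequences\<close>

lemma wf_digraph_O_graph: "wf_digraph (O_graph d)"
  by unfold_locales (auto simp: O_graph_def)

lemma verts_O_graph: "verts (O_graph d) = O_sequences d"
  by (simp add: O_graph_def)

lemma head_O_graph: "head (O_graph d) = snd"
  by (simp add: O_graph_def)

lemma tail_O_graph: "tail (O_graph d) = fst"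
  by (simp add: O_graph_def)

lemma root_nth:
  assumes "2 \<le> s"
  shows "seq_of_list ([1, m] @ replicate (s - 2) 1) n =
    (if n = 1 then m else if n < s then 1 else 0)"
  using assms
  by (auto simp: nth_default_def nth_append nth_Cons split: nat.splits)

lemma root_in_O_sequences:
  assumes "2 \<le> s" "s \<le> d"
  defines "h \<equiv> seq_of_list ([1, d - s + 1] @ replicate (s - 2) 1)"
  shows "h \<in> O_sequences d" "seq_length h = s"
proof -
  have h: "h n = (if n = 1 then d - s + 1 else if n < s then 1 else 0)" for n
    unfolding h_def by (rule root_nth) fact
  have "h (Suc t) \<le> binomial_shift (h t) t" if "1 \<le> t" for t
    using that binomial_shift_pos[of t "h t"] by (auto simp: h Suc_le_eq)
  then have fin: "finite_O_sequence h"
    using assms(1,2) h[of 0] h[of s] unfolding finite_O_sequence_def O_sequence_def by auto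
  show len: "seq_length h = s"
    by (rule seq_length_eqI) (use assms(1) in \<open>auto simp: h\<close>)
  \<comment> \<open>Every index below \<open>s\<close> contributes 1, and index 1 carries the excess
    \<open>d - s\<close>.\<close>
  have "(\<Sum>i<s. h i) = (\<Sum>i<s. 1 + (if i = 1 then d - s else 0))"
    by (rule sum.cong) (auto simp: h)
  also have "\<dots> = d"
    using assms(1,2) by (simp add: sum.distrib del: One_nat_def)
  finally show "h \<in> O_sequences d"
    using fin len by (simp add: O_sequences_def multiplicity_of_def)
qed

text \<open>Positivity below \<open>s\<close> fixes all entries except the one at 1, and the
  multiplicity fixes that one.\<close>

lemma O_sequence_eq_root:
  assumes h: "h \<in> O_sequences d" and len: "seq_length h = s" "2 \<le> s" "s \<le> d"
    and le: "\<And>j. 2 \<le> j \<Longrightarrow> h j \<le> 1"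
  shows "h = seq_of_list ([1, d - s + 1] @ replicate (s - 2) 1)"
proof -
  have fin: "finite_O_sequence h" and mult: "(\<Sum>i<s. h i) = d"
    using h len by (auto simp: O_sequences_def multiplicity_of_def)
  have h0: "h 0 = 1" using fin by (simp add: finite_O_sequence_def O_sequence_def)
  have pos: "0 < h n \<longleftrightarrow> n < s" for n
    using finite_O_sequence_pos_iff[OF fin] len by simp
  have other: "h n = (if n < s then 1 else 0)" if "n \<noteq> 1" for n
  proof -
    have "h n \<le> 1" using that le[of n] h0 by (cases "n = 0") auto
    then show ?thesis using pos[of n] by auto
  qed
  have "d = (\<Sum>i<s. 1 + (if i = 1 then h 1 - 1 else 0))"
    unfolding mult[symmetric] using pos[of 1] len
    by (intro sum.cong) (auto simp: other)
  also have "\<dots> = s + (h 1 - 1)"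
    using len by (simp add: sum.distrib del: One_nat_def)
  finally have "h 1 = d - s + 1" using pos[of 1] len by simp
  then have "h n = seq_of_list ([1, d - s + 1] @ replicate (s - 2) 1) n" for n
    unfolding root_nth[OF len(2)] using other[of n] by auto
  then show ?thesis by (rule ext)
qed

lemma O_graph_parent:
  assumes h: "h \<in> O_sequences d" and "2 \<le> d" and "h \<noteq> seq_of_list [1, d - 1]"
  shows "\<exists>h'. (h', h) \<in> arcs (O_graph d) \<and> h 1 < h' 1"
proof -
  define j where "j = seq_length h - 1"
  have fin: "finite_O_sequence h" and mult: "multiplicity_of h = d"
    using h by (auto simp: O_sequences_def)
  note pos = finite_O_sequence_pos_iff[OF fin]
  have h0: "h 0 = 1" using fin by (simp add: finite_O_sequence_def O_sequence_def)
  \<comment> \<open>Length 1 would give multiplicity 1, and a sequence of length 2 is the root,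
    which is the case \<open>s = 2\<close> of \<open>O_sequence_eq_root\<close>.\<close>
  have "\<not> seq_length h \<le> 2"
  proof
    assume *: "seq_length h \<le> 2"
    then have "d = h 0 + h 1"
      using multiplicity_of_eq_sum[OF fin *] mult by (simp add: numeral_2_eq_2)
    then have "seq_length h = 2"
      using * pos[of 1] \<open>2 \<le> d\<close> h0 by auto
    moreover have "h j \<le> 1" if "2 \<le> j" for j
      using that * pos[of j] by linarith
    ultimately have "h = seq_of_list ([1, d - 2 + 1] @ replicate (2 - 2) 1)"
      using \<open>2 \<le> d\<close> h by (intro O_sequence_eq_root) simp_all
    moreover have "d - 2 + 1 = d - 1" using \<open>2 \<le> d\<close> by simp
    ultimately show False using assms(3) by simp
  qed
  then have j: "1 < j" "0 < h j" "h (Suc j) = 0"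
    using pos[of j] pos[of "Suc j"] by (auto simp: j_def)
  \<comment> \<open>The next entry is 0, so this holds even if \<open>h j - 1 = 0\<close>.\<close>
  have "h (Suc j) \<le> binomial_shift (h j - 1) j" using j(3) by simp
  then show ?thesis
    using O_sequences_transfer(2)[OF h j(1,2)] j(1)
    by (intro exI[of _ "h(1 := Suc (h 1), j := h j - 1)"]) simp
qed

lemma O_graph_length_parent:
  assumes h: "h \<in> O_sequences d" and len: "seq_length h = s" "2 \<le> s" "s \<le> d"
    and ne: "h \<noteq> seq_of_list ([1, d - s + 1] @ replicate (s - 2) 1)"
  shows "\<exists>h'. (h', h) \<in> arcs (O_graph d) \<and> h 1 < h' 1 \<and> h' \<in> O_sequences d \<and> seq_length h' = s"
proof -
  have fin: "finite_O_sequence h" using h by (auto simp: O_sequences_def)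
  note pos = finite_O_sequence_pos_iff[OF fin]
  let ?P = "\<lambda>j. 2 \<le> j \<and> 2 \<le> h j"
  define j where "j = (GREATEST j. ?P j)"
  \<comment> \<open>Otherwise all entries from index 2 on are at most 1, and \<open>h\<close> is the
    root.\<close>
  have "\<exists>j. ?P j"
  proof (rule ccontr)
    assume "\<nexists>j. ?P j"
    then have "\<not> 2 \<le> h j" if "2 \<le> j" for j using that by blast
    then have "h j \<le> 1" if "2 \<le> j" for j using that by force
    then show False using O_sequence_eq_root[OF h len] ne by blast
  qed
  moreover have bound: "y \<le> s" if "?P y" for y
    using that pos[of y] len by auto
  ultimately have "?P j"
    unfolding j_def by (rule GreatestI_ex_nat)
  have max: "y \<le> j" if "?P y" for y
    unfolding j_def using that bound by (rule Greatest_le_nat)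
  have j: "1 < j" "0 < h j" "2 \<le> h j" using \<open>?P j\<close> by auto
  have "h (Suc j) \<le> 1" using max[of "Suc j"] j(1) by linarith
  also have "1 \<le> binomial_shift (h j - 1) j"
    using binomial_shift_pos[of j "h j - 1"] j by simp
  finally have step: "h (Suc j) \<le> binomial_shift (h j - 1) j" .
  define h' where "h' = h(1 := Suc (h 1), j := h j - 1)"
  \<comment> \<open>The decreased entry stays positive because \<open>h j\<close> is at least 2, so
    the support is unchanged.\<close>
  have "0 < h' t \<longleftrightarrow> t < s" for t
    using pos[of t] j len by (auto simp: h'_def)
  then have "seq_length h' = s" by (rule seq_length_eqI)
  moreover have "h 1 < h' 1" using j by (simp add: h'_def)
  ultimately show ?thesis
    using O_sequences_transfer[OF h j(1,2) step] unfolding h'_def by blast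
qed

theorem proposition2p9:
  shows "(\<forall>d::nat. d \<ge> 2 \<longrightarrow>
            (\<exists>T. rooted_spanning_tree T (O_graph d) (seq_of_list [1, d - 1])))
       \<and> (\<forall>(d::nat) (s::nat). d \<ge> s \<and> s \<ge> 2 \<longrightarrow>
            (\<exists>T. rooted_spanning_tree T (O_graph_length d s)
                   (seq_of_list ([1, d - s + 1] @ replicate (s - 2) 1)))
            \<and> connected (O_graph_length d s))"
proof (intro conjI allI impI)
  fix d :: nat assume d: "2 \<le> d"
  show "\<exists>T. rooted_spanning_tree T (O_graph d) (seq_of_list [1, d - 1])"
  \<comment> \<open>All vertices have \<open>h 1 \<le> d\<close>, so the truncated difference
    strictly drops when the entry at 1 grows.\<close>
  proof (rule rooted_spanning_tree_exists[where rank = "\<lambda>h. d - h 1"])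
    have "d - 2 + 1 = d - 1" using d by simp
    then show "seq_of_list [1, d - 1] \<in> verts (O_graph d)"
      using root_in_O_sequences(1)[of 2 d] d by (simp add: verts_O_graph)
  next
    fix h assume h: "h \<in> verts (O_graph d)" "h \<noteq> seq_of_list [1, d - 1]"
    then obtain h' where h': "(h', h) \<in> arcs (O_graph d)" "h 1 < h' 1"
      using O_graph_parent d by (auto simp: verts_O_graph)
    then have "h' 1 \<le> d"
      by (intro O_sequences_entry_le) (auto simp: O_graph_def)
    then show "\<exists>e \<in> arcs (O_graph d). head (O_graph d) e = h \<and>
        d - tail (O_graph d) e 1 < d - h 1"
      using h' by (intro bexI[of _ "(h', h)"]) (auto simp: head_O_graph tail_O_graph)
  qed (rule wf_digraph_O_graph)
next
  fix d s :: nat assume ds: "s \<le> d \<and> 2 \<le> s"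
  let ?r = "seq_of_list ([1, d - s + 1] @ replicate (s - 2) 1)"
  let ?G = "O_graph_length d s"
  have verts: "verts ?G = {h \<in> O_sequences d. seq_length h = s}"
    by (simp add: O_graph_length_def)
  \<comment> \<open>The restriction keeps the arcs with both ends of length \<open>s\<close>, so a
    parent has to preserve the length.\<close>
  have arcs: "arcs ?G = {(h', h) \<in> arcs (O_graph d). h' \<in> verts ?G \<and> h \<in> verts ?G}"
    by (auto simp: O_graph_length_def head_O_graph tail_O_graph)
  have ends: "head ?G = snd" "tail ?G = fst"
    by (simp_all add: O_graph_length_def head_O_graph tail_O_graph)
  show tree: "\<exists>T. rooted_spanning_tree T ?G ?r"
  proof (rule rooted_spanning_tree_exists[where rank = "\<lambda>h. d - h 1"])
    show "wf_digraph ?G"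
      by unfold_locales (auto simp: arcs ends)
    show "?r \<in> verts ?G"
      using root_in_O_sequences[of s d] ds by (simp add: verts)
  next
    fix h assume h: "h \<in> verts ?G" "h \<noteq> ?r"
    then obtain h' where h': "(h', h) \<in> arcs (O_graph d)" "h 1 < h' 1" "h' \<in> verts ?G"
      using O_graph_length_parent[of h d s] ds by (auto simp: verts)
    then have "h' 1 \<le> d"
      by (intro O_sequences_entry_le) (auto simp: verts)
    then show "\<exists>e \<in> arcs ?G. head ?G e = h \<and> d - tail ?G e 1 < d - h 1"
      using h h' by (intro bexI[of _ "(h', h)"]) (auto simp: arcs ends)
  qed
  show "connected ?G" using tree by (elim exE) (rule rooted_spanning_tree_imp_connected)
qed

end
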